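(* Let $k_1, k_2, k_3, \dots$ be the enumeration of the rationals in $(0,1)$ obtained by reading the Kepler tree level by level from the top down, each level from left to right (so $k_1=\frac12,\ k_2=\frac13,\ k_3=\frac23,\ k_4=\frac14,\ k_5=\frac34,\ k_6=\frac25,\ k_7=\frac35,\ k_8=\frac15,\dots$). Let $\mathcal{K}\in(0,1)$ be the irrational number whose infinite continued fraction digit sequence is obtained by concatenating, in this order, the reduced finite continued fraction expansions of $k_1,k_2,k_3,\dots$, i.e. $$\mathcal{K} = [2,\ 3,\ 1,2,\ 4,\ 1,3,\ 2,2,\ 1,1,2,\ 5,\ \cdots].$$ Then $\mathcal{K}$ is Minkowski normal.
   Context: $\mathbb{N}=\{1,2,3,\dots\}$. Continued fractions: $[a_1,a_2,a_3,\cdots]$ denotes the (finite or infinite) regular continued fraction $\cfrac{1}{a_1+\cfrac{1}{a_2+\cfrac{1}{a_3+\ddots}}}$ with digits $a_i\in\mathbb{N}$. Every rational in $(0,1)$ is written in its reduced form $[a_1,\dots,a_n]$ with $a_n\ge 2$, which is unique. Kepler tree: the infinite binary tree with root $\frac12$ (level $0$) in which every node $p/q$ has left child $p/(p+q)$ and right child $q/(p+q)$. Equivalently, in continued fraction form, the root is $[2]$ and the node $[a_1,a_2,\dots,a_n]$ has left child $[a_1+1,a_2,\dots,a_n]$ and right child $[1,a_1,a_2,\dots,a_n]$. Level $l$ has $2^l$ nodes. Minkowski normality: for $x=[a_1,a_2,a_3,\cdots]\in[0,1)$ with infinite continued fraction expansion and a block $d=d_1,d_2,\dots,d_k$ of digits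 $d_i\in\mathbb{N}$, let $G_n(x,d)$ denote the number of occurrences of $d$ as a block of consecutive digits in the first $n$ digits $a_1,\dots,a_n$ (the number of $i$ with $1\le i\le n-k+1$ and $a_{i+j-1}=d_j$ for all $1\le j\le k$). The number $x$ is Minkowski normal if for every $k\ge1$ and every block $d=d_1,\dots,d_k$ with $d_i\in\mathbb{N}$, $$\lim_{n\to\infty}\frac1n G_n(x,d)=2^{-(d_1+d_2+\cdots+d_k)}.$$ *)

theory Defs
  imports Complex_Main
begin

text \<open>Digit sequences and enumerations are indexed from 0: the digit \<open>a\<^sub>i\<close> and the rational
  \<open>k\<^sub>i\<close> of the text are \<open>a (i - 1)\<close> and \<open>kepler_enum (i - 1)\<close>.\<close>

fun cf_value :: "nat list \<Rightarrow> 'a::field" where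
  "cf_value [] = 0"
| "cf_value (a # as) = 1 / (of_nat a + cf_value as)"

definition is_reduced_cf :: "rat \<Rightarrow> nat list \<Rightarrow> bool" where
  "is_reduced_cf q as \<longleftrightarrow>
     as \<noteq> [] \<and> (\<forall>a\<in>set as. 1 \<le> a) \<and> 2 \<le> last as \<and> cf_value as = q"

definition reduced_cf :: "rat \<Rightarrow> nat list" where
  "reduced_cf q = (THE as. is_reduced_cf q as)"

definition has_cf :: "real \<Rightarrow> (nat \<Rightarrow> nat) \<Rightarrow> bool" where
  "has_cf x a \<longleftrightarrow> (\<forall>i. 1 \<le> a i) \<and> (\<lambda>n. cf_value (map a [0..<n])) \<longlonglongrightarrow> x"

definition block_count :: "(nat \<Rightarrow> nat) \<Rightarrow> nat list \<Rightarrow> nat \<Rightarrow> nat" where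
  "block_count a d n = card {i. i + length d \<le> n \<and> (\<forall>j<length d. a (i + j) = d ! j)}"

text \<open>The digit sequence quantified over here is unique, see \<open>has_cf_unique\<close> below.\<close>

definition minkowski_normal :: "real \<Rightarrow> bool" where
  "minkowski_normal x \<longleftrightarrow> 0 \<le> x \<and> x < 1 \<and>
     (\<exists>a. has_cf x a \<and>
       (\<forall>d. d \<noteq> [] \<and> (\<forall>e\<in>set d. 1 \<le> e) \<longrightarrow>
          (\<lambda>n. real (block_count a d n) / real n) \<longlonglongrightarrow> 1 / 2 ^ sum_list d))"

definition kepler_children :: "rat \<Rightarrow> rat list" where
  "kepler_children x = (case quotient_of x of (p, q) \<Rightarrow> [Fract p (p + q), Fract q (p + q)])"

fun kepler_level :: "nat \<Rightarrow> rat list" where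
  "kepler_level 0 = [1 / 2]"
| "kepler_level (Suc l) = concat (map kepler_children (kepler_level l))"

text \<open>The infinite concatenation \<open>f 0 @ f 1 @ f 2 @ \<dots>\<close> of nonempty lists. Its first
  \<open>n + 1\<close> lists have at least \<open>n + 1\<close> entries in total, so they determine the entry at
  position \<open>n\<close>.\<close>

definition concat_seq :: "(nat \<Rightarrow> 'a list) \<Rightarrow> nat \<Rightarrow> 'a" where
  "concat_seq f n = concat (map f [0..<Suc n]) ! n"

definition kepler_enum :: "nat \<Rightarrow> rat" where
  "kepler_enum = concat_seq kepler_level"

definition kepler_digits :: "nat \<Rightarrow> nat" where
  "kepler_digits = concat_seq (\<lambda>n. reduced_cf (kepler_enum n))"

definition kepler_number :: real where
  "kepler_number = lim (\<lambda>n. cf_value (map kepler_digits [0..<n]))"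

lemma concat_seq_nth:
  assumes ne: "\<And>i. f i \<noteq> []" and n: "n < length (concat (map f [0..<m]))"
  shows "concat (map f [0..<m]) ! n = concat_seq f n"
proof -
  have len: "length (concat (map f [0..<k])) \<ge> k" for k
  proof (induction k)
    case (Suc k)
    have "length (f k) \<ge> 1" using ne[of k] by (cases "f k") auto
    then show ?case using Suc by simp
  qed simp
  have ext: "concat (map f [0..<k + j]) ! n = concat (map f [0..<k]) ! n"
    if "n < length (concat (map f [0..<k]))" for k j
  proof -
    have "[0..<k + j] = [0..<k] @ [k..<k + j]" using upt_add_eq_append[of 0 k j] by simp
    then have "concat (map f [0..<k + j]) = concat (map f [0..<k]) @ concat (map f [k..<k + j])"
      by (simp only: map_append concat_append)
    then show ?thesis using that by (simp only: nth_append if_True)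
  qed
  show ?thesis
  proof (cases "m \<le> Suc n")
    case True
    then have "concat (map f [0..<Suc n]) ! n = concat (map f [0..<m]) ! n"
      using ext[OF n, of "Suc n - m"] by (metis le_add_diff_inverse)
    then show ?thesis unfolding concat_seq_def by simp
  next
    case False
    have "n < length (concat (map f [0..<Suc n]))" using len[of "Suc n"] by linarith
    from ext[OF this, of "m - Suc n"] False
    have "concat (map f [0..<m]) ! n = concat (map f [0..<Suc n]) ! n"
      by (metis le_add_diff_inverse nat_le_linear)
    then show ?thesis unfolding concat_seq_def by simp
  qed
qed

lemma cf_value_nonneg: "0 \<le> (cf_value as :: 'a::linordered_field)"
  by (induction as) auto

lemma cf_value_le_1: "\<forall>a\<in>set as. 1 \<le> a \<Longrightarrow> (cf_value as :: 'a::linordered_field) \<le> 1"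
proof (cases as)
  case (Cons a bs)
  assume "\<forall>a\<in>set as. 1 \<le> a"
  then have "1 \<le> (of_nat a :: 'a)" using Cons by simp
  then have "1 \<le> (of_nat a :: 'a) + cf_value bs" using cf_value_nonneg[of bs, where 'a='a] by linarith
  then show ?thesis using Cons by simp
qed simp

lemma cf_value_pos:
  "as \<noteq> [] \<Longrightarrow> \<forall>a\<in>set as. 1 \<le> a \<Longrightarrow> 0 < (cf_value as :: 'a::linordered_field)"
proof (cases as)
  case (Cons a bs)
  assume "\<forall>a\<in>set as. 1 \<le> a"
  then have "1 \<le> (of_nat a :: 'a)" using Cons by simp
  then have "1 \<le> (of_nat a :: 'a) + cf_value bs" using cf_value_nonneg[of bs, where 'a='a] by linarith
  then show ?thesis using Cons by simp
qed simp

lemma cf_value_less_1: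
  "as \<noteq> [] \<Longrightarrow> \<forall>a\<in>set as. 1 \<le> a \<Longrightarrow> 2 \<le> last as \<Longrightarrow> (cf_value as :: 'a::linordered_field) < 1"
proof (cases as)
  case (Cons a bs)
  assume h: "\<forall>a\<in>set as. 1 \<le> a" "2 \<le> last as"
  have a: "1 \<le> (of_nat a :: 'a)" using h Cons by simp
  have "1 < (of_nat a :: 'a) + cf_value bs"
  proof (cases "bs = []")
    case True
    then have "2 \<le> a" using h Cons by simp
    then show ?thesis using True by simp
  next
    case False
    then have "0 < (cf_value bs :: 'a)" using h Cons by (intro cf_value_pos) auto
    then show ?thesis using a by linarith
  qed
  then show ?thesis using Cons by simp
qed simp

lemma nat_add_frac_unique:
  fixes s t :: "'a::linordered_field"
  assumes eq: "of_nat a + s = of_nat b + t" and "0 \<le> s" "s < 1" "0 \<le> t" "t < 1"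
  shows "a = b"
proof (rule ccontr)
  assume "a \<noteq> b"
  then consider "a + 1 \<le> b" | "b + 1 \<le> a" by linarith
  then show False
  proof cases
    case 1
    then have "(of_nat (a + 1) :: 'a) \<le> of_nat b" by (rule of_nat_mono)
    then show False using assms by simp
  next
    case 2
    then have "(of_nat (b + 1) :: 'a) \<le> of_nat a" by (rule of_nat_mono)
    then show False using assms by simp
  qed
qed

lemma is_reduced_cf_unique:
  "is_reduced_cf q as \<Longrightarrow> is_reduced_cf q bs \<Longrightarrow> as = bs"
proof (induction as arbitrary: q bs)
  case Nil
  then show ?case by (simp add: is_reduced_cf_def)
next
  case (Cons a as)
  from Cons.prems(2) obtain b bs' where bs: "bs = b # bs'"
    by (cases bs) (auto simp: is_reduced_cf_def)
  let ?s = "cf_value as :: rat" and ?t = "cf_value bs' :: rat"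
  have s: "0 \<le> ?s" "?s < 1"
  proof -
    show "?s < 1"
    proof (cases "as = []")
      case False
      show ?thesis
        by (rule cf_value_less_1[OF False])
        (use Cons.prems(1) False in \<open>auto simp: is_reduced_cf_def\<close>)
    qed simp
  qed (rule cf_value_nonneg)
  have t: "0 \<le> ?t" "?t < 1"
  proof -
    show "?t < 1"
    proof (cases "bs' = []")
      case False
      show ?thesis
        by (rule cf_value_less_1[OF False])
        (use Cons.prems(2) False in \<open>auto simp: is_reduced_cf_def bs\<close>)
    qed simp
  qed (rule cf_value_nonneg)
  have "1 / (of_nat a + ?s) = 1 / (of_nat b + ?t)"
    using Cons.prems bs by (simp add: is_reduced_cf_def)
  then have eq: "of_nat a + ?s = of_nat b + ?t" by (metis div_by_1 divide_divide_eq_right mult_1)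
  then have ab: "a = b" using s t by (rule nat_add_frac_unique)
  with eq have st: "?s = ?t" by simp
  have "as = bs'"
  proof (cases "as = [] \<or> bs' = []")
    case True
    have "?s \<noteq> 0" if "as \<noteq> []"
      using cf_value_pos[of as, where 'a=rat] that Cons.prems(1) by (auto simp: is_reduced_cf_def)
    moreover have "?t \<noteq> 0" if "bs' \<noteq> []"
      using cf_value_pos[of bs', where 'a=rat] that Cons.prems(2) bs by (auto simp: is_reduced_cf_def)
    ultimately show ?thesis using True st by (metis cf_value.simps(1))
  next
    case False
    then have "is_reduced_cf ?s as" "is_reduced_cf ?s bs'"
      using Cons.prems bs st by (auto simp: is_reduced_cf_def)
    then show ?thesis by (rule Cons.IH)
  qed
  with ab bs show ?case by simp
qed

lemma reduced_cf_eqI: "is_reduced_cf q as \<Longrightarrow> reduced_cf q = as"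
  unfolding reduced_cf_def using is_reduced_cf_unique by blast

lemma is_reduced_cf_pos: "is_reduced_cf q as \<Longrightarrow> 0 < q"
  using cf_value_pos unfolding is_reduced_cf_def by blast

lemma kepler_children_eq:
  assumes "0 < x"
  shows "kepler_children x = [1 / (1 + 1 / x), 1 / (1 + x)]"
proof -
  obtain p q where pq: "quotient_of x = (p, q)" by (cases "quotient_of x")
  have q: "0 < q" using quotient_of_denom_pos[OF pq] .
  have x: "x = of_int p / of_int q" using quotient_of_div[OF pq] .
  then have p: "0 < p" using assms q by (simp add: zero_less_divide_iff)
  have "Fract p (p + q) = 1 / (1 + 1 / x)" "Fract q (p + q) = 1 / (1 + x)"
    using p q unfolding x Fract_of_int_quotient by (simp_all add: field_simps)
  then show ?thesis by (simp add: kepler_children_def pq)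
qed

text \<open>The two children in terms of continued fraction digits.\<close>

lemma kepler_children_cf:
  assumes "is_reduced_cf x (a # as)"
  shows "\<exists>y z. kepler_children x = [y, z] \<and>
           is_reduced_cf y (Suc a # as) \<and> is_reduced_cf z (1 # a # as)"
proof -
  have x: "x = 1 / (of_nat a + cf_value as)" using assms by (simp add: is_reduced_cf_def)
  have "is_reduced_cf (1 / (1 + 1 / x)) (Suc a # as)" "is_reduced_cf (1 / (1 + x)) (1 # a # as)"
    using assms by (auto simp: is_reduced_cf_def x split: if_splits)
  with kepler_children_eq[OF is_reduced_cf_pos[OF assms]] show ?thesis by blast
qed

lemma kepler_level_reduced: "x \<in> set (kepler_level l) \<Longrightarrow> is_reduced_cf x (reduced_cf x)"
proof (induction l arbitrary: x)
  case 0
  then have "is_reduced_cf x [2]" by (simp add: is_reduced_cf_def)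
  then show ?case using reduced_cf_eqI by simp
next
  case (Suc l)
  then obtain w where w: "w \<in> set (kepler_level l)" "x \<in> set (kepler_children w)" by auto
  have "is_reduced_cf w (reduced_cf w)" using Suc.IH[OF w(1)] .
  moreover obtain a as where "reduced_cf w = a # as"
    using calculation by (cases "reduced_cf w") (auto simp: is_reduced_cf_def)
  ultimately obtain bs where "is_reduced_cf x bs"
    using kepler_children_cf[of w a as] w(2) by auto
  then show ?case using reduced_cf_eqI by simp
qed

lemma length_kepler_level: "length (kepler_level l) = 2 ^ l"
proof (induction l)
  case (Suc l)
  have "length (kepler_children x) = 2" for x
    by (simp add: kepler_children_def split: prod.split)
  then have "length (concat (map kepler_children xs)) = 2 * length xs" for xs
    by (induction xs) auto
  then show ?case using Suc by simp
qed simp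

lemma kepler_level_nonempty: "kepler_level l \<noteq> []"
  using length_kepler_level[of l] by auto

lemma concat_seq_mem:
  assumes "\<And>i. f i \<noteq> []"
  shows "\<exists>i. concat_seq f n \<in> set (f i)"
proof -
  have "length (concat (map f [0..<k])) \<ge> k" for k
  proof (induction k)
    case (Suc k)
    have "length (f k) \<ge> 1" using assms[of k] by (cases "f k") auto
    then show ?case using Suc by simp
  qed simp
  from this[of "Suc n"] have "n < length (concat (map f [0..<Suc n]))" by linarith
  from nth_mem[OF this] show ?thesis unfolding concat_seq_def by auto
qed

lemma kepler_enum_reduced: "is_reduced_cf (kepler_enum n) (reduced_cf (kepler_enum n))"
  using concat_seq_mem[of kepler_level n] kepler_level_nonempty kepler_level_reduced
  unfolding kepler_enum_def by blast

lemma kepler_digits_pos: "1 \<le> kepler_digits n"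
proof -
  have "reduced_cf (kepler_enum i) \<noteq> []" for i
    using kepler_enum_reduced[of i] by (simp add: is_reduced_cf_def)
  from concat_seq_mem[of "\<lambda>i. reduced_cf (kepler_enum i)", OF this, of n]
  obtain i where "kepler_digits n \<in> set (reduced_cf (kepler_enum i))"
    unfolding kepler_digits_def by blast
  then show ?thesis using kepler_enum_reduced[of i] by (simp add: is_reduced_cf_def)
qed

lemma cf_tail_contract:
  fixes s t :: real
  assumes "\<forall>a\<in>set as. 1 \<le> a" "0 \<le> s" "0 \<le> t"
  defines "W \<equiv> \<lambda>u. foldr (\<lambda>a t. 1 / (real a + t)) as u"
  shows "0 \<le> W s \<and> 0 \<le> W t \<and> \<bar>W s - W t\<bar> \<le> (1 / 2) ^ (length as div 2) * \<bar>s - t\<bar>"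
  using assms(1) unfolding W_def
proof (induction as rule: induct_list012)
  case (2 a)
  have "1 \<le> real a" using 2 by simp
  moreover have "1 \<le> (real a + s) * (real a + t)"
    using mult_mono[of 1 "real a + s" 1 "real a + t"] calculation assms(2,3) by simp
  moreover have "1 / (real a + s) - 1 / (real a + t) = (t - s) / ((real a + s) * (real a + t))"
    using calculation assms(2,3) by (simp add: field_simps)
  then have "\<bar>1 / (real a + s) - 1 / (real a + t)\<bar> = \<bar>s - t\<bar> / ((real a + s) * (real a + t))"
    using calculation by (simp add: abs_minus_commute)
  ultimately show ?case
    using assms(2,3) by (simp add: divide_le_eq mult_le_cancel_left1)
next
  case (3 a b as)
  let ?f = "\<lambda>u. foldr (\<lambda>a t. 1 / (real a + t)) as u"
  define u v where "u = ?f s" and "v = ?f t"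
  have uv: "0 \<le> u" "0 \<le> v" "\<bar>u - v\<bar> \<le> (1 / 2) ^ (length as div 2) * \<bar>s - t\<bar>"
    using 3 by (auto simp: u_def v_def)
  have ab: "1 \<le> real a" "1 \<le> real b" using 3 by auto
  have aux: "2 \<le> real a * (real b + w) + 1" if "0 \<le> w" for w
    using mult_mono[of 1 "real a" 1 "real b + w"] ab that by simp
  have "1 / (real a + 1 / (real b + w)) = (real b + w) / (real a * (real b + w) + 1)"
    if "0 \<le> w" for w
    using ab that by (simp add: field_simps)
  then have "1 / (real a + 1 / (real b + u)) - 1 / (real a + 1 / (real b + v))
      = (real b + u) / (real a * (real b + u) + 1) - (real b + v) / (real a * (real b + v) + 1)"
    using uv by simp
  also have "\<dots> = (u - v) / ((real a * (real b + u) + 1) * (real a * (real b + v) + 1))"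
    using aux[OF uv(1)] aux[OF uv(2)] by (simp add: diff_frac_eq algebra_simps)
  finally have "\<bar>1 / (real a + 1 / (real b + u)) - 1 / (real a + 1 / (real b + v))\<bar>
      = \<bar>u - v\<bar> / ((real a * (real b + u) + 1) * (real a * (real b + v) + 1))"
    using aux[OF uv(1)] aux[OF uv(2)] by (simp add: abs_mult)
  also have "\<dots> \<le> \<bar>u - v\<bar> / 2"
    using mult_mono[OF aux[OF uv(1)] aux[OF uv(2)]] aux[OF uv(1)]
    by (intro divide_left_mono) auto
  also have "\<dots> \<le> (1 / 2) ^ (length (a # b # as) div 2) * \<bar>s - t\<bar>"
    using uv(3) by simp
  finally show ?case using uv ab by (simp add: u_def v_def)
qed (use assms in auto)

lemma cf_value_append:
  "(cf_value (as @ bs) :: real) = foldr (\<lambda>a t. 1 / (real a + t)) as (cf_value bs)"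
  by (induction as) auto

lemma cf_convergent:
  assumes pos: "\<forall>i. 1 \<le> a i"
  shows "convergent (\<lambda>n. cf_value (map a [0..<n]) :: real)"
proof -
  let ?c = "\<lambda>n. cf_value (map a [0..<n]) :: real"
  have *: "\<bar>?c (N + k) - ?c N\<bar> \<le> (1 / 2) ^ (N div 2)" for N k
  proof -
    let ?t = "cf_value (map a [N..<N + k]) :: real"
    have t: "0 \<le> ?t" "?t \<le> 1" using pos by (auto intro!: cf_value_nonneg cf_value_le_1)
    have e: "?c (N + k) = foldr (\<lambda>a t. 1 / (real a + t)) (map a [0..<N]) ?t"
      unfolding cf_value_append[symmetric] map_append[symmetric]
      using upt_add_eq_append[of 0 N k] by simp
    have e': "?c N = foldr (\<lambda>a t. 1 / (real a + t)) (map a [0..<N]) 0"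
      using cf_value_append[of "map a [0..<N]" "[]"] by simp
    have "\<bar>?c (N + k) - ?c N\<bar> \<le> (1 / 2) ^ (N div 2) * \<bar>?t - 0\<bar>"
      using cf_tail_contract[of "map a [0..<N]" ?t 0] t pos unfolding e e' by simp
    also have "\<dots> \<le> (1 / 2) ^ (N div 2) * 1" using t by (intro mult_left_mono) auto
    finally show ?thesis by simp
  qed
  have "Cauchy ?c"
  proof (rule CauchyI')
    fix e :: real assume "0 < e"
    then obtain M where M: "(1 / 2) ^ M < e" using real_arch_pow_inv[of e "1/2"] by auto
    show "\<exists>M. \<forall>m\<ge>M. \<forall>n>m. dist (?c m) (?c n) < e"
    proof (intro exI[of _ "2 * M"] allI impI)
      fix m n :: nat assume mn: "2 * M \<le> m" "m < n"
      have "dist (?c m) (?c n) \<le> (1 / 2) ^ (m div 2)"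
        using *[of m "n - m"] mn by (simp add: dist_real_def abs_minus_commute)
      also have "\<dots> \<le> (1 / 2) ^ M" using mn by (intro power_decreasing) auto
      finally show "dist (?c m) (?c n) < e" using M by linarith
    qed
  qed
  then show ?thesis by (simp add: Cauchy_convergent_iff)
qed

lemma has_cf_step:
  assumes "has_cf x a"
  shows "\<exists>y. has_cf y (\<lambda>i. a (Suc i)) \<and> 0 \<le> y \<and> y \<le> 1 \<and> x = 1 / (real (a 0) + y)"
proof -
  have pos: "\<forall>i. 1 \<le> a i" and lim: "(\<lambda>n. cf_value (map a [0..<n])) \<longlonglongrightarrow> x"
    using assms by (auto simp: has_cf_def)
  let ?c = "\<lambda>n. cf_value (map (\<lambda>i. a (Suc i)) [0..<n]) :: real"
  obtain y where y: "?c \<longlonglongrightarrow> y"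
    using cf_convergent[of "\<lambda>i. a (Suc i)"] pos unfolding convergent_def by auto
  have y0: "0 \<le> y" by (rule LIMSEQ_le_const[OF y]) (auto intro: cf_value_nonneg)
  have y1: "y \<le> 1" by (rule LIMSEQ_le_const2[OF y], intro exI allI impI cf_value_le_1) (use pos in auto)
  have a0: "1 \<le> real (a 0)" using pos by simp
  have "map a [0..<Suc n] = a 0 # map (\<lambda>i. a (Suc i)) [0..<n]" for n
    by (simp add: upt_conv_Cons map_Suc_upt[symmetric] del: upt_Suc)
  then have "(\<lambda>n. cf_value (map a [0..<Suc n]) :: real) = (\<lambda>n. 1 / (real (a 0) + ?c n))"
    by (simp del: upt_Suc)
  moreover have "(\<lambda>n. 1 / (real (a 0) + ?c n)) \<longlonglongrightarrow> 1 / (real (a 0) + y)"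
    using y y0 a0 by (intro tendsto_intros) auto
  ultimately have "x = 1 / (real (a 0) + y)"
    using LIMSEQ_unique[OF LIMSEQ_Suc[OF lim]] by simp
  then show ?thesis using y y0 y1 pos by (auto simp: has_cf_def)
qed

lemma has_cf_bounds:
  assumes "has_cf x a"
  shows "0 < x \<and> x < 1"
proof -
  obtain y where y: "has_cf y (\<lambda>i. a (Suc i))" "0 \<le> y" "x = 1 / (real (a 0) + y)"
    using has_cf_step[OF assms] by blast
  obtain z where z: "0 \<le> z" "y = 1 / (real (a 1) + z)"
    using has_cf_step[OF y(1)] by auto
  have "1 \<le> real (a 0)" "1 \<le> real (a 1)" using assms by (auto simp: has_cf_def)
  moreover from this z have "0 < y" by simp
  ultimately show ?thesis using y by simp
qed

lemma has_cf_unique: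
  assumes "has_cf x a" "has_cf x b"
  shows "a = b"
proof
  fix i
  show "a i = b i" using assms
  proof (induction i arbitrary: x a b)
    case (0 x a b)
    obtain y where y: "has_cf y (\<lambda>i. a (Suc i))" "x = 1 / (real (a 0) + y)"
      using has_cf_step[OF 0(1)] by blast
    obtain z where z: "has_cf z (\<lambda>i. b (Suc i))" "x = 1 / (real (b 0) + z)"
      using has_cf_step[OF 0(2)] by blast
    have "real (a 0) + y = real (b 0) + z"
      using y(2) z(2) by (metis div_by_1 divide_divide_eq_right mult_1)
    then show ?case using has_cf_bounds[OF y(1)] has_cf_bounds[OF z(1)]
      by (intro nat_add_frac_unique[of "a 0" y "b 0" z]) auto
  next
    case (Suc i x a b)
    obtain y where y: "has_cf y (\<lambda>i. a (Suc i))" "x = 1 / (real (a 0) + y)"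
      using has_cf_step[OF Suc.prems(1)] by blast
    obtain z where z: "has_cf z (\<lambda>i. b (Suc i))" "x = 1 / (real (b 0) + z)"
      using has_cf_step[OF Suc.prems(2)] by blast
    have eq: "real (a 0) + y = real (b 0) + z"
      using y(2) z(2) by (metis div_by_1 divide_divide_eq_right mult_1)
    then have "a 0 = b 0" using has_cf_bounds[OF y(1)] has_cf_bounds[OF z(1)]
      by (intro nat_add_frac_unique[of "a 0" y "b 0" z]) auto
    with eq have "y = z" by simp
    then show ?case using Suc.IH[of y "\<lambda>i. a (Suc i)" "\<lambda>i. b (Suc i)"] y z by simp
  qed
qed

lemma has_cf_irrational:
  assumes "has_cf x a"
  shows "x \<notin> \<rat>"
proof -
  have "x \<noteq> real p / real q" if "has_cf x a" for p q x a
    using that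
  proof (induction q arbitrary: p x a rule: less_induct)
    case (less q)
    show ?case
    proof
      assume x: "x = real p / real q"
      have b: "0 < x" "x < 1" using has_cf_bounds[OF less.prems] by auto
      have p: "0 < p" "0 < q" using b x by (auto intro: Nat.gr0I)
      have pq: "p < q" using b x p by simp
      obtain y where y: "has_cf y (\<lambda>i. a (Suc i))" "x = 1 / (real (a 0) + y)"
        using has_cf_step[OF less.prems] by blast
      have y0: "0 < y" using has_cf_bounds[OF y(1)] by simp
      have "real (a 0) + y = real q / real p"
        using y(2) x by (metis div_by_1 divide_divide_eq_right mult_1)
      then have yy: "y * real p = real q - real (a 0 * p)" using p by (simp add: field_simps)
      moreover have "0 < y * real p" using y0 p by simp
      ultimately have "a 0 * p \<le> q" by linarith
      with yy have "y = real (q - a 0 * p) / real p" using p by (simp add: field_simps)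
      with less.IH[OF pq y(1)] show False by blast
    qed
  qed
  moreover have "\<exists>p q. x = real p / real q" if "x \<in> \<rat>"
    using Rats_abs_nat_div_natE[OF that] has_cf_bounds[OF assms]
    by (metis abs_of_pos)
  ultimately show ?thesis using assms by blast
qed

lemma kepler_number_has_cf: "has_cf kepler_number kepler_digits"
  using cf_convergent[of kepler_digits] kepler_digits_pos
  by (simp add: has_cf_def kepler_number_def convergent_LIMSEQ_iff)

lemma kepler_number_bounds: "0 < kepler_number" "kepler_number < 1"
  using has_cf_bounds[OF kepler_number_has_cf] by auto

lemma kepler_number_irrational: "kepler_number \<notin> \<rat>"
  using has_cf_irrational[OF kepler_number_has_cf] .

lemma kepler_enum_initial:
  "map kepler_enum [0..<8] = [1/2, 1/3, 2/3, 1/4, 3/4, 2/5, 3/5, 1/5]"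
proof -
  have four: "[0..<4] = [0, Suc 0, Suc (Suc 0), Suc (Suc (Suc 0))]"
    by (simp add: upt_rec)
  define L where "L = concat (map kepler_level [0..<4])"
  have L: "L = [1/2, 1/3, 2/3, 1/4, 3/4, 2/5, 3/5, 1/5, 4/5, 3/7, 4/7, 2/7, 5/7, 3/8, 5/8]"
    unfolding L_def four by (simp add: kepler_children_eq)
  have "kepler_enum n = L ! n" if "n < length L" for n
    using concat_seq_nth[of kepler_level n 4] kepler_level_nonempty that
    by (simp add: kepler_enum_def L_def)
  then have "kepler_enum n = L ! n" if "n < 15" for n
    using that by (simp add: L)
  then have "map kepler_enum [0..<8] = map ((!) L) [0..<8]"
    by simp
  also have "\<dots> = [1/2, 1/3, 2/3, 1/4, 3/4, 2/5, 3/5, 1/5]"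
    by (simp add: L upt_rec)
  finally show ?thesis .
qed

lemma kepler_digits_initial:
  "map kepler_digits [0..<13] = [2, 3, 1, 2, 4, 1, 3, 2, 2, 1, 1, 2, 5]"
proof -
  let ?r = "\<lambda>n. reduced_cf (kepler_enum n)"
  define D where "D = concat (map ?r [0..<8])"
  have "D = concat (map reduced_cf (map kepler_enum [0..<8]))"
    by (simp add: D_def comp_def)
  moreover have "reduced_cf (1/2) = [2]" "reduced_cf (1/3) = [3]" "reduced_cf (2/3) = [1, 2]"
    "reduced_cf (1/4) = [4]" "reduced_cf (3/4) = [1, 3]" "reduced_cf (2/5) = [2, 2]"
    "reduced_cf (3/5) = [1, 1, 2]" "reduced_cf (1/5) = [5]"
    by (rule reduced_cf_eqI, simp add: is_reduced_cf_def)+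
  ultimately have D: "D = [2, 3, 1, 2, 4, 1, 3, 2, 2, 1, 1, 2, 5]"
    by (simp add: kepler_enum_initial del: map_map)
  have ne: "?r i \<noteq> []" for i
    using kepler_enum_reduced[of i] by (simp add: is_reduced_cf_def)
  have "kepler_digits n = D ! n" if "n < length D" for n
    using concat_seq_nth[of ?r n 8, OF ne] that
    by (simp only: kepler_digits_def D_def)
  then have "map kepler_digits [0..<length D] = D"
    by (intro nth_equalityI) auto
  moreover have "length D = 13" by (simp add: D)
  ultimately show ?thesis by (simp only: D)
qed

end

theory Submission
  imports Defs "HOL-Library.Sublist"
begin

text \<open>Let \<open>S\<close> be the digit sum of the block \<open>d\<close>, and let the discrepancy of a word \<open>w\<close> be the number
  of occurrences of \<open>d\<close> in \<open>w\<close> minus \<open>length w / 2\<^sup>S\<close>. Passing to the two children of \<open>w\<close> changes only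
  the front of the word, so the discrepancies of the children add up to twice the discrepancy of
  \<open>w\<close>, up to a term that counts words starting with \<open>d\<close>. Among the \<open>2\<^sup>j\<close> descendants of depth
  \<open>j \<ge> S\<close> exactly \<open>2\<^sup>j / 2\<^sup>S\<close> start with \<open>d\<close>, and the correction terms cancel: from depth \<open>S\<close> on
  the total discrepancy of a generation exactly doubles. An initial segment of a level is a disjoint
  union of such generations, one for each binary digit, so that the first \<open>M\<close> words have total
  discrepancy \<open>O(M)\<close>, as have the seams between words. Since words on level \<open>l\<close> have average length
  \<open>1 + l / 2\<close>, the first \<open>M\<close> words contain more than any multiple of \<open>M\<close> digits.\<close>

section \<open>Counting blocks in finite words\<close>

text \<open>The recursion runs at the front of the word because that is where the tree operations
  act. The empty block is found \<open>length xs\<close> times.\<close>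

fun occ :: "'a list \<Rightarrow> 'a list \<Rightarrow> nat" where
  "occ d [] = 0"
| "occ d (x # xs) = of_bool (prefix d (x # xs)) + occ d xs"

lemma occ_le_length: "occ d xs \<le> length xs"
  by (induction xs) auto

lemma occ_append_ge: "occ d xs + occ d ys \<le> occ d (xs @ ys)"
proof (induction xs)
  case (Cons x xs)
  have "prefix d ((x # xs) @ ys)" if "prefix d (x # xs)"
    using prefix_prefix[OF that] .
  then show ?case using Cons by auto
qed simp

text \<open>An extra occurrence starts in \<open>xs\<close> and runs into \<open>ys\<close>, hence
  starts at one of the last \<open>length d\<close> positions of \<open>xs\<close>. The
  \<open>min\<close> makes the induction work: it grows with \<open>xs\<close> as long as
  \<open>x # xs\<close> is shorter than \<open>d\<close>, and afterwards no new extra occurrence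
  arises.\<close>

lemma occ_append_le_min: "occ d (xs @ ys) \<le> occ d xs + occ d ys + min (length d) (length xs)"
proof (induction xs)
  case (Cons x xs)
  have "prefix d (x # xs)" if "prefix d ((x # xs) @ ys)" "length d \<le> length (x # xs)"
    using prefix_length_prefix[OF that(1) _ that(2)] by simp
  then show ?case using Cons by (cases "length d \<le> length (x # xs)") auto
qed simp

lemma occ_append_le: "occ d (xs @ ys) \<le> occ d xs + occ d ys + length d"
  using occ_append_le_min[of d xs ys] by linarith

lemma occ_concat_ge: "sum_list (map (occ d) ws) \<le> occ d (concat ws)"
proof (induction ws)
  case (Cons w ws)
  then show ?case using occ_append_ge[of d w "concat ws"] by simp
qed simp

lemma occ_concat_le: "occ d (concat ws) \<le> sum_list (map (occ d) ws) + length d * length ws"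
proof (induction ws)
  case (Cons w ws)
  then show ?case using occ_append_le[of d w "concat ws"] by simp
qed simp

lemma prefix_map_upt_iff:
  "prefix d (map a [0..<n]) \<longleftrightarrow> length d \<le> n \<and> (\<forall>j<length d. a j = d ! j)"
proof
  assume "prefix d (map a [0..<n])"
  then obtain zs where zs: "map a [0..<n] = d @ zs" by (auto simp: prefix_def)
  have "length d \<le> n" using arg_cong[OF zs, of length] by simp
  moreover have "a j = d ! j" if "j < length d" for j
    using arg_cong[OF zs, of "\<lambda>xs. xs ! j"] that calculation by (simp add: nth_append)
  ultimately show "length d \<le> n \<and> (\<forall>j<length d. a j = d ! j)" by simp
next
  assume "length d \<le> n \<and> (\<forall>j<length d. a j = d ! j)"
  then have "d = take (length d) (map a [0..<n])" by (intro nth_equalityI) auto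
  then show "prefix d (map a [0..<n])" by (metis take_is_prefix)
qed

text \<open>Start positions are split into 0 and the positive ones, which belong to the shifted
  sequence; hence \<open>a\<close> is generalised. For the empty block the two counts differ:
  \<open>n + 1\<close> against \<open>n\<close>.\<close>

lemma block_count_eq_occ:
  assumes "d \<noteq> []"
  shows "block_count a d n = occ d (map a [0..<n])"
proof (induction n arbitrary: a)
  case 0
  then show ?case using assms by (simp add: block_count_def)
next
  case (Suc n)
  let ?A = "\<lambda>a n. {i. i + length d \<le> n \<and> (\<forall>j<length d. a (i + j) = d ! j)}"
  have fin: "finite (?A a n)" for a n by (rule finite_subset[of _ "{..n}"]) auto
  have "?A a (Suc n) = {i. i = 0 \<and> prefix d (map a [0..<Suc n])} \<union> Suc ` ?A (\<lambda>i. a (Suc i)) n"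
    (is "_ = ?B \<union> ?C")
  proof (rule set_eqI)
    fix i
    show "i \<in> ?A a (Suc n) \<longleftrightarrow> i \<in> ?B \<union> ?C"
      by (cases i) (auto simp only: prefix_map_upt_iff mem_Collect_eq Un_iff add_0 image_iff
          Suc_inject nat.distinct simp_thms add_Suc Suc_le_mono)
  qed
  moreover have "card (?B \<union> ?C) = card ?B + card ?C"
    by (intro card_Un_disjoint finite_imageI fin) auto
  moreover have "card ?B = of_bool (prefix d (map a [0..<Suc n]))" by simp
  moreover have "card ?C = block_count (\<lambda>i. a (Suc i)) d n"
    unfolding block_count_def by (simp add: card_image)
  ultimately have "block_count a d (Suc n)
      = of_bool (prefix d (map a [0..<Suc n])) + occ d (map (\<lambda>i. a (Suc i)) [0..<n])"
    using Suc.IH by (simp add: block_count_def del: upt_Suc)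
  moreover have "map a [0..<Suc n] = a 0 # map (\<lambda>i. a (Suc i)) [0..<n]"
    by (simp add: upt_conv_Cons map_Suc_upt[symmetric] del: upt_Suc)
  ultimately show ?case by (simp del: upt_Suc)
qed

section \<open>Block frequencies in concatenated words\<close>

lemma map_concat_seq:
  assumes "\<And>i. f i \<noteq> []" "n \<le> length (concat (map f [0..<m]))"
  shows "map (concat_seq f) [0..<n] = take n (concat (map f [0..<m]))"
proof (rule nth_equalityI)
  show "length (map (concat_seq f) [0..<n]) = length (take n (concat (map f [0..<m])))"
    using assms(2) by simp
next
  fix i assume "i < length (map (concat_seq f) [0..<n])"
  then show "map (concat_seq f) [0..<n] ! i = take n (concat (map f [0..<m])) ! i"
    using concat_seq_nth[of f i m, OF assms(1)] assms(2) by simp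
qed

lemma sum_list_map_upt: "sum_list (map g [0..<n]) = (\<Sum>i<n. g i)"
  by (simp add: interv_sum_list_conv_sum_set_nat atLeast0LessThan)

text \<open>The first \<open>n\<close> digits are \<open>M\<close> complete words and a piece of the
  next one. All errors are of order \<open>M + 1\<close>, while \<open>n\<close> eventually exceeds
  every multiple of \<open>M + 1\<close>.\<close>

lemma block_frequency_concat_seq:
  fixes W :: "nat \<Rightarrow> nat list" and p K C :: real
  assumes ne: "\<And>i. W i \<noteq> []" and d: "d \<noteq> []" and p: "0 \<le> p" "p \<le> 1"
    and disc: "\<And>M. \<bar>\<Sum>i<M. real (occ d (W i)) - p * real (length (W i))\<bar> \<le> K * (real M + 1)"
    and len: "\<And>M. real (length (W M)) \<le> C * (real M + 1)"
    and superlinear: "\<And>c. \<forall>\<^sub>F M in sequentially. c * (real M + 1) \<le> (\<Sum>i<M. real (length (W i)))"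
  shows "(\<lambda>n. real (block_count (concat_seq W) d n) / real n) \<longlonglongrightarrow> p"
proof -
  let ?G = "block_count (concat_seq W) d"
  define L where "L M = (\<Sum>i<M. length (W i))" for M
  \<comment> \<open>\<open>K\<close> pays for the complete words, \<open>length d\<close> for each
    seam and \<open>C\<close> for the incomplete word.\<close>
  define K' where "K' = K + real (length d) + C"
  have L_Suc: "L (Suc M) = L M + length (W M)" for M by (simp add: L_def)
  have L_mono: "L M \<le> L N" if "M \<le> N" for M N
    using that unfolding L_def by (intro sum_mono2) auto
  have L_ge: "M \<le> L M" for M
  proof (induction M)
    case (Suc M)
    have "1 \<le> length (W M)" using ne[of M] by (cases "W M") auto
    then show ?case using Suc by (simp add: L_Suc)
  qed simp
  have len_concat: "length (concat (map W [0..<M])) = L M" for M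
    by (simp add: length_concat L_def sum_list_map_upt comp_def del: upt_Suc)
  have approx: "\<exists>M. L M \<le> n \<and> n < L (Suc M) \<and> \<bar>real (?G n) - p * real n\<bar> \<le> K' * (real M + 1)" for n
  proof -
    obtain M where M: "L M \<le> n" "n < L (Suc M)"
    proof -
      define N where "N = (LEAST N. n < L N)"
      have ex: "n < L (Suc n)" using L_ge[of "Suc n"] by simp
      have N: "n < L N" unfolding N_def using ex by (rule LeastI)
      then obtain M where "N = Suc M" by (cases N) (auto simp: L_def)
      moreover have "\<not> n < L M" using \<open>N = Suc M\<close> not_less_Least[of M "\<lambda>N. n < L N"] N_def by simp
      ultimately show thesis using that[of M] N by simp
    qed
    define r where "r = n - L M"
    have r: "n = L M + r" "r < length (W M)" using M by (auto simp: r_def L_Suc)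
    define xs where "xs = concat (map W [0..<M])"
    define ys where "ys = take r (W M)"
    have "map (concat_seq W) [0..<n] = take n (concat (map W [0..<Suc M]))"
      using M(2) len_concat[of "Suc M"] by (intro map_concat_seq ne) simp
    also have "\<dots> = xs @ ys" using r len_concat[of M] by (simp add: xs_def ys_def)
    finally have G: "?G n = occ d (xs @ ys)" by (simp add: block_count_eq_occ[OF d])
    define s where "s = (\<Sum>i<M. occ d (W i))"
    have s: "sum_list (map (occ d) (map W [0..<M])) = s"
      by (simp add: s_def sum_list_map_upt comp_def)
    have "s \<le> ?G n"
      using occ_concat_ge[of d "map W [0..<M]"] occ_append_ge[of d xs ys] s G xs_def by simp
    moreover have "?G n \<le> s + length d * (M + 1) + r"
      using occ_concat_le[of d "map W [0..<M]"] occ_append_le[of d xs ys] s G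
        occ_le_length[of d ys] r(2) by (simp add: xs_def[symmetric] ys_def)
    ultimately have G_bounds: "real s \<le> real (?G n)"
        "real (?G n) \<le> real s + real (length d) * (real M + 1) + real r"
      by (simp, metis (mono_tags, lifting) of_nat_1 of_nat_add of_nat_le_iff of_nat_mult)
    have "\<bar>real s - p * real (L M)\<bar> \<le> K * (real M + 1)"
      using disc[of M] by (simp add: s_def L_def sum_subtractf sum_distrib_left)
    moreover have "0 \<le> p * real r" "p * real r \<le> real r" using p by (auto intro: mult_left_le_one_le)
    moreover have "real r \<le> C * (real M + 1)" using len[of M] r(2) by linarith
    moreover have "0 \<le> real (length d) * (real M + 1)" by simp
    ultimately have "\<bar>real (?G n) - p * real n\<bar> \<le> K' * (real M + 1)"
      using G_bounds unfolding r(1) K'_def of_nat_add ring_distribs by linarith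
    with M show ?thesis by blast
  qed
  show ?thesis
  proof (rule LIMSEQ_I)
    fix e :: real assume e: "0 < e"
    \<comment> \<open>The added 1 makes the final estimate strict and keeps the factor
      positive.\<close>
    obtain N where N: "\<And>M. N \<le> M \<Longrightarrow> (\<bar>K'\<bar> + 1) / e * (real M + 1) \<le> real (L M)"
      using superlinear[of "(\<bar>K'\<bar> + 1) / e"] unfolding eventually_sequentially L_def of_nat_sum by blast
    show "\<exists>n0. \<forall>n\<ge>n0. norm (real (?G n) / real n - p) < e"
    proof (intro exI[of _ "L N"] allI impI)
      fix n assume n: "L N \<le> n"
      obtain M where M: "L M \<le> n" "n < L (Suc M)" "\<bar>real (?G n) - p * real n\<bar> \<le> K' * (real M + 1)"
        using approx[of n] by blast
      have "N \<le> M" using L_mono[of "Suc M" N] n M(2) by (meson leD leI le_trans Suc_leI)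
      then have "(\<bar>K'\<bar> + 1) / e * (real M + 1) \<le> real n" using N[of M] M(1) by linarith
      then have *: "(\<bar>K'\<bar> + 1) * (real M + 1) \<le> e * real n" using e by (simp add: field_simps)
      have "K' * (real M + 1) < (\<bar>K'\<bar> + 1) * (real M + 1)" by (intro mult_strict_right_mono) auto
      with * M(3) have **: "\<bar>real (?G n) - p * real n\<bar> < e * real n" by linarith
      then have "0 < n" by (intro gr0I) auto
      then have "real (?G n) / real n - p = (real (?G n) - p * real n) / real n"
        by (simp add: field_simps)
      then show "norm (real (?G n) / real n - p) < e"
        using ** \<open>0 < n\<close> by (simp add: pos_divide_less_eq)
    qed
  qed
qed

section \<open>Generations of the Kepler tree\<close>

definition cf_children :: "nat list \<Rightarrow> nat list list" where
  "cf_children w = [Suc (hd w) # tl w, 1 # w]"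

fun descendants :: "nat list \<Rightarrow> nat \<Rightarrow> nat list list" where
  "descendants u 0 = [u]"
| "descendants u (Suc j) = concat (map cf_children (descendants u j))"

text \<open>The definition adds a generation at the bottom, like \<open>kepler_level\<close>.
  Splitting at the root instead shows the two halves of a generation as generations of the children,
  which allows induction with \<open>u\<close> varying.\<close>

lemma descendants_Suc:
  "descendants u (Suc j) = descendants (Suc (hd u) # tl u) j @ descendants (1 # u) j"
proof (induction j)
  case 0
  then show ?case by (simp add: cf_children_def)
next
  case (Suc j)
  show ?case
    by (subst descendants.simps(2), subst Suc) (simp only: map_append concat_append descendants.simps)
qed

lemma length_descendants: "length (descendants u j) = 2 ^ j"
  by (induction j arbitrary: u) (simp_all add: descendants_Suc del: descendants.simps(2))

lemma sum_list_descendants_Suc: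
  fixes g :: "nat list \<Rightarrow> 'a::comm_monoid_add"
  shows "sum_list (map g (descendants u (Suc j)))
    = sum_list (map (\<lambda>w. g (Suc (hd w) # tl w) + g (1 # w)) (descendants u j))"
proof -
  have "sum_list (map g (concat (map cf_children ws)))
      = sum_list (map (\<lambda>w. g (Suc (hd w) # tl w) + g (1 # w)) ws)" for ws
    by (induction ws) (auto simp: cf_children_def ac_simps)
  then show ?thesis by simp
qed

lemma descendants_hd_pos:
  assumes "u \<noteq> []" "0 < hd u" "w \<in> set (descendants u j)"
  shows "w \<noteq> [] \<and> 0 < hd w"
  using assms by (induction j arbitrary: w) (auto simp: cf_children_def)

lemma length_descendant_le:
  assumes "w \<in> set (descendants u j)" "u \<noteq> []"
  shows "length w \<le> length u + j"
  using assms
proof (induction j arbitrary: u)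
  case (Suc j)
  have "w \<in> set (descendants (Suc (hd u) # tl u) j) \<union> set (descendants (1 # u) j)"
    using Suc.prems(1) by (simp add: descendants_Suc del: descendants.simps(2))
  then show ?case
    using Suc.IH[of "Suc (hd u) # tl u"] Suc.IH[of "1 # u"] Suc.prems(2) by auto
qed simp

text \<open>A left child is as long as its parent and a right child one digit longer, so each
  generation raises the average length by 1/2.\<close>

lemma sum_length_descendants:
  assumes "u \<noteq> []"
  shows "sum_list (map (\<lambda>w. real (length w)) (descendants u j)) = 2 ^ j * (real (length u) + real j / 2)"
  using assms
proof (induction j arbitrary: u)
  case (Suc j)
  then show ?case
    by (simp add: descendants_Suc Suc.IH field_simps del: descendants.simps(2))
qed simp

text \<open>Each unit of the digit sum costs one generation. Words starting with
  \<open>1 # d\<close> are the right children of words starting with \<open>d\<close>; words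
  starting with \<open>Suc e # d\<close>, where \<open>e\<close> is positive, are the left children
  of words starting with \<open>e # d\<close>.\<close>

lemma count_prefix_descendants:
  assumes "u \<noteq> []" "0 < hd u" "\<forall>e\<in>set d. 1 \<le> e"
  shows "sum_list (map (\<lambda>w. of_bool (prefix d w)) (descendants u (j + sum_list d))) = (2 ^ j :: real)"
    (is "?P (j + sum_list d) d = _")
  using assms(3)
proof (induction d)
  case Nil
  then show ?case by (simp add: sum_list_triv length_descendants)
next
  case (Cons e d)
  have pos: "w \<noteq> [] \<and> 0 < hd w" if "w \<in> set (descendants u i)" for w i
    using descendants_hd_pos[OF assms(1,2) that] .
  \<comment> \<open>Heads are positive, so a left child has head at least 2 and cannot start with
    1.\<close>
  have one: "?P (Suc i) (1 # d) = ?P i d" for i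
    unfolding sum_list_descendants_Suc
    by (intro arg_cong[where f = sum_list] map_cong refl) (use pos in auto)
  have Suc: "?P (Suc i) (Suc e # d) = ?P i (e # d)" if "1 \<le> e" for i e
    unfolding sum_list_descendants_Suc
  proof (intro arg_cong[where f = sum_list] map_cong refl)
    fix w assume "w \<in> set (descendants u i)"
    then have "w \<noteq> []" using pos by blast
    then obtain a as where "w = a # as" by (cases w) auto
    then show "of_bool (prefix (Suc e # d) (Suc (hd w) # tl w)) + of_bool (prefix (Suc e # d) (1 # w))
        = (of_bool (prefix (e # d) w) :: real)"
      using that by simp
  qed
  have "1 \<le> e" using Cons.prems by simp
  then have "?P (j + (e + sum_list d)) (e # d) = 2 ^ j"
  proof (induction e rule: dec_induct)
    case base
    then show ?case using one[of "j + sum_list d"] Cons by simp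
  next
    case (step n)
    then show ?case using Suc[of n "j + (n + sum_list d)"] by simp
  qed
  then show ?case by simp
qed

section \<open>Discrepancy\<close>

definition discrepancy :: "nat list \<Rightarrow> nat list \<Rightarrow> real" where
  "discrepancy d w = real (occ d w) - real (length w) / 2 ^ sum_list d"

lemma abs_discrepancy_le: "\<bar>discrepancy d w\<bar> \<le> real (length w)"
proof -
  have "real (length w) / 2 ^ sum_list d \<le> real (length w) / 1"
    by (intro divide_left_mono) auto
  moreover have "0 \<le> real (length w) / 2 ^ sum_list d" by simp
  moreover have "real (occ d w) \<le> real (length w)" using occ_le_length[of d w] by simp
  ultimately show ?thesis unfolding discrepancy_def by linarith
qed

text \<open>Both children contain \<open>tl w\<close> unchanged, and the right one all of
  \<open>w\<close>; only occurrences at the front differ. The last term comes from the one extra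
  digit of the right child.\<close>

lemma discrepancy_children:
  assumes "w \<noteq> []"
  shows "discrepancy d (Suc (hd w) # tl w) + discrepancy d (1 # w) = 2 * discrepancy d w
    + (of_bool (prefix d (Suc (hd w) # tl w)) + of_bool (prefix d (1 # w)))
    - of_bool (prefix d w) - 1 / 2 ^ sum_list d"
  using assms by (cases w) (auto simp: discrepancy_def field_simps)

lemma discrepancy_descendants_Suc:
  assumes "u \<noteq> []" "0 < hd u" "\<forall>e\<in>set d. 1 \<le> e" "sum_list d \<le> j"
  shows "sum_list (map (discrepancy d) (descendants u (Suc j)))
    = 2 * sum_list (map (discrepancy d) (descendants u j))"
proof -
  let ?P = "\<lambda>w. of_bool (prefix d w) :: real"
  let ?D = "descendants u"
  obtain i where i: "j = i + sum_list d" using assms(4) by (metis add.commute le_Suc_ex)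
  have "sum_list (map (discrepancy d) (?D (Suc j))) = sum_list (map (\<lambda>w. 2 * discrepancy d w
      + (?P (Suc (hd w) # tl w) + ?P (1 # w)) - ?P w - 1 / 2 ^ sum_list d) (?D j))"
    unfolding sum_list_descendants_Suc
    by (intro arg_cong[where f = sum_list] map_cong refl discrepancy_children)
      (use descendants_hd_pos[OF assms(1,2)] in blast)
  also have "\<dots> = 2 * sum_list (map (discrepancy d) (?D j)) + sum_list (map ?P (?D (Suc j)))
      - sum_list (map ?P (?D j)) - 2 ^ j / 2 ^ sum_list d"
    unfolding sum_list_descendants_Suc
    by (simp add: sum_list_subtractf sum_list_addf sum_list_const_mult sum_list_triv length_descendants)
  also have "sum_list (map ?P (?D (Suc j))) = 2 ^ Suc i"
    using count_prefix_descendants[OF assms(1-3), of "Suc i"] i by simp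
  also have "sum_list (map ?P (?D j)) = 2 ^ i"
    using count_prefix_descendants[OF assms(1-3), of i] i by simp
  \<comment> \<open>Since \<open>2 ^ j / 2 ^ sum_list d = 2 ^ i\<close>, the corrections
    \<open>2 ^ Suc i - 2 ^ i - 2 ^ i\<close> cancel.\<close>
  finally show ?thesis by (simp add: i power_add)
qed

lemma abs_sum_list_le:
  fixes g :: "'a \<Rightarrow> real"
  assumes "\<And>x. x \<in> set xs \<Longrightarrow> \<bar>g x\<bar> \<le> c"
  shows "\<bar>sum_list (map g xs)\<bar> \<le> c * real (length xs)"
  using assms
proof (induction xs)
  case (Cons x xs)
  then have "\<bar>g x\<bar> \<le> c" "\<bar>sum_list (map g xs)\<bar> \<le> c * real (length xs)" by auto
  then show ?case by (simp add: algebra_simps)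
qed simp

text \<open>Up to depth \<open>sum_list d\<close> each discrepancy is bounded by the length of its
  word; beyond that depth exact doubling preserves the average.\<close>

lemma discrepancy_descendants_le:
  assumes "u \<noteq> []" "0 < hd u" "\<forall>e\<in>set d. 1 \<le> e"
  shows "\<bar>sum_list (map (discrepancy d) (descendants u j))\<bar> \<le> 2 ^ j * (real (length u) + real (sum_list d))"
proof -
  have small: "\<bar>sum_list (map (discrepancy d) (descendants u j))\<bar>
      \<le> 2 ^ j * (real (length u) + real (sum_list d))" if "j \<le> sum_list d" for j
  proof -
    have "\<bar>discrepancy d w\<bar> \<le> real (length u) + real (sum_list d)" if "w \<in> set (descendants u j)" for w
      using abs_discrepancy_le[of d w] length_descendant_le[OF that assms(1)] \<open>j \<le> sum_list d\<close>
      by linarith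
    from abs_sum_list_le[of "descendants u j" "discrepancy d", OF this] show ?thesis
      by (simp add: length_descendants mult.commute)
  qed
  show ?thesis
  proof (cases "j \<le> sum_list d")
    case False
    then have "sum_list d \<le> j" by simp
    then show ?thesis
    proof (induction j rule: dec_induct)
      case base
      show ?case by (rule small) simp
    next
      case (step j)
      then show ?case
        by (simp add: discrepancy_descendants_Suc[OF assms step(1)] abs_mult del: descendants.simps(2))
    qed
  qed (rule small)
qed

text \<open>The summand \<open>1\<close> makes the bound reproduce itself: the left half costs
  \<open>2\<^sup>j (length u + S)\<close>, and the first part of the right half costs \<open>2\<^sup>j (length u + 1 + S + 1)\<close>.\<close>

lemma discrepancy_take_descendants_le:
  assumes "u \<noteq> []" "0 < hd u" "\<forall>e\<in>set d. 1 \<le> e"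
  shows "\<bar>sum_list (map (discrepancy d) (take m (descendants u j)))\<bar>
    \<le> 2 ^ j * (real (length u) + real (sum_list d) + 1)"
  using assms(1,2)
proof (induction j arbitrary: u m)
  case 0
  have "\<bar>discrepancy d u\<bar> \<le> real (length u) + real (sum_list d) + 1"
    using abs_discrepancy_le[of d u] by linarith
  then show ?case by (cases m) auto
next
  case (Suc j)
  let ?s = "real (length u) + real (sum_list d)"
  define u1 u2 where "u1 = Suc (hd u) # tl u" and "u2 = 1 # u"
  have u1: "u1 \<noteq> []" "0 < hd u1" "length u1 = length u" using Suc.prems by (auto simp: u1_def)
  have u2: "u2 \<noteq> []" "0 < hd u2" "length u2 = Suc (length u)" by (auto simp: u2_def)
  have D: "descendants u (Suc j) = descendants u1 j @ descendants u2 j"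
    unfolding u1_def u2_def by (rule descendants_Suc)
  show ?case
  proof (cases "m \<le> 2 ^ j")
    case True
    then have "take m (descendants u (Suc j)) = take m (descendants u1 j)"
      unfolding D by (simp add: length_descendants)
    then have "\<bar>sum_list (map (discrepancy d) (take m (descendants u (Suc j))))\<bar> \<le> 2 ^ j * (?s + 1)"
      using Suc.IH[OF u1(1,2)] u1(3) by (simp del: descendants.simps(2))
    also have "\<dots> \<le> 2 ^ Suc j * (?s + 1)" by (intro mult_right_mono) auto
    finally show ?thesis .
  next
    case False
    then have t: "take m (descendants u (Suc j)) = descendants u1 j @ take (m - 2 ^ j) (descendants u2 j)"
      unfolding D by (simp add: length_descendants)
    have "\<bar>sum_list (map (discrepancy d) (descendants u1 j))\<bar> \<le> 2 ^ j * ?s"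
      using discrepancy_descendants_le[OF u1(1,2) assms(3)] u1(3) by simp
    moreover have "\<bar>sum_list (map (discrepancy d) (take (m - 2 ^ j) (descendants u2 j)))\<bar>
        \<le> 2 ^ j * (?s + 2)"
      using Suc.IH[OF u2(1,2), of "m - 2 ^ j"] u2(3) by (simp add: algebra_simps)
    ultimately show ?thesis unfolding t by (simp add: algebra_simps)
  qed
qed

section \<open>The Kepler enumeration\<close>

definition kepler_word :: "nat \<Rightarrow> nat list" where
  "kepler_word n = reduced_cf (kepler_enum n)"

text \<open>Transfers the tree from rationals to digit words, keeping the order within each
  level.\<close>

lemma reduced_cf_kepler_level: "map reduced_cf (kepler_level l) = descendants [2] l"
proof (induction l)
  case 0
  have "reduced_cf (1 / 2) = [2]" by (rule reduced_cf_eqI) (simp add: is_reduced_cf_def)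
  then show ?case by simp
next
  case (Suc l)
  have children: "map reduced_cf (kepler_children x) = cf_children (reduced_cf x)"
    if "x \<in> set (kepler_level l)" for x
  proof -
    have x: "is_reduced_cf x (reduced_cf x)" using kepler_level_reduced[OF that] .
    then obtain a as where a: "reduced_cf x = a # as"
      by (cases "reduced_cf x") (auto simp: is_reduced_cf_def)
    then obtain y z where "kepler_children x = [y, z]"
        "is_reduced_cf y (Suc a # as)" "is_reduced_cf z (1 # a # as)"
      using kepler_children_cf[of x a as] x by auto
    then show ?thesis using reduced_cf_eqI by (simp add: a cf_children_def)
  qed
  have "map reduced_cf (kepler_level (Suc l)) = concat (map (cf_children \<circ> reduced_cf) (kepler_level l))"
    using children by (simp add: map_concat comp_def cong: map_cong)
  also have "\<dots> = descendants [2] (Suc l)" by (simp add: Suc[symmetric])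
  finally show ?case .
qed

lemma length_concat_kepler_level: "length (concat (map kepler_level [0..<l])) = 2 ^ l - 1"
  by (induction l) (auto simp: length_kepler_level)

text \<open>The levels before \<open>l\<close> hold \<open>2 ^ l - 1\<close> words. The case
  \<open>m = 2 ^ l\<close> is included so that \<open>Suc m\<close> may be inserted for
  \<open>m < 2 ^ l\<close>.\<close>

lemma map_kepler_word:
  assumes "m \<le> 2 ^ l"
  shows "map kepler_word [0..<2 ^ l - 1 + m]
    = concat (map (descendants [2]) [0..<l]) @ take m (descendants [2] l)"
proof -
  have "map kepler_enum [0..<2 ^ l - 1 + m] = take (2 ^ l - 1 + m) (concat (map kepler_level [0..<Suc l]))"
    unfolding kepler_enum_def
    by (intro map_concat_seq kepler_level_nonempty)
      (use assms length_concat_kepler_level[of "Suc l"] in auto)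
  also have "\<dots> = concat (map kepler_level [0..<l]) @ take m (kepler_level l)"
    using length_concat_kepler_level[of l] by simp
  finally have "map reduced_cf (map kepler_enum [0..<2 ^ l - 1 + m])
      = map reduced_cf (concat (map kepler_level [0..<l]) @ take m (kepler_level l))" by simp
  then show ?thesis
    by (simp add: kepler_word_def[abs_def] comp_def map_concat take_map[symmetric] reduced_cf_kepler_level)
qed

text \<open>Here \<open>l\<close> is the level of the word with index \<open>M\<close>. Since
  \<open>2 ^ l \<le> M + 1\<close>, bounds in \<open>2 ^ l\<close> become bounds in
  \<open>M + 1\<close>.\<close>

lemma kepler_index:
  fixes M :: nat
  obtains l m where "M = 2 ^ l - 1 + m" "m < 2 ^ l"
proof -
  obtain l where "2 ^ l \<le> M + 1" "M + 1 < 2 ^ (l + 1)"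
    using ex_power_ivl1[of 2 "M + 1"] by auto
  then show thesis using that[of l "M + 1 - 2 ^ l"] by auto
qed

lemma sum_kepler_word:
  fixes g :: "nat list \<Rightarrow> real"
  assumes "m \<le> 2 ^ l"
  shows "(\<Sum>i<2 ^ l - 1 + m. g (kepler_word i)) = (\<Sum>l'<l. sum_list (map g (descendants [2] l')))
    + sum_list (map g (take m (descendants [2] l)))"
proof -
  have "(\<Sum>i<2 ^ l - 1 + m. g (kepler_word i)) = sum_list (map g (map kepler_word [0..<2 ^ l - 1 + m]))"
    by (simp add: sum_list_map_upt comp_def)
  moreover have "sum_list (map g (concat (map (descendants [2]) [0..<l])))
      = (\<Sum>l'<l. sum_list (map g (descendants [2] l')))"
    by (induction l) simp_all
  ultimately show ?thesis by (simp only: map_kepler_word[OF assms] map_append sum_list_append)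
qed

lemma discrepancy_kepler_word_le:
  assumes "\<forall>e\<in>set d. 1 \<le> e"
  shows "\<bar>\<Sum>i<M. discrepancy d (kepler_word i)\<bar> \<le> 2 * (real (sum_list d) + 2) * (real M + 1)"
proof -
  obtain l m where M: "M = 2 ^ l - 1 + m" and m: "m < 2 ^ l" using kepler_index .
  \<comment> \<open>This is \<open>length [2] + sum_list d + 1\<close>. The complete levels and the
    partial level each cost at most \<open>2 ^ l * ?c\<close>, whence the factor 2.\<close>
  let ?c = "real (sum_list d) + 2"
  have "\<bar>\<Sum>l'<l. sum_list (map (discrepancy d) (descendants [2] l'))\<bar> \<le> (\<Sum>l'<l. 2 ^ l' * ?c)"
  proof (intro order_trans[OF sum_abs] sum_mono)
    fix l'
    have "take (2 ^ l') (descendants [2] l') = descendants [2] l'" by (simp add: length_descendants)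
    then show "\<bar>sum_list (map (discrepancy d) (descendants [2] l'))\<bar> \<le> 2 ^ l' * ?c"
      using discrepancy_take_descendants_le[of "[2]" d "2 ^ l'" l'] assms by (simp add: ac_simps)
  qed
  also have "\<dots> = (2 ^ l - 1) * ?c" by (simp flip: sum_distrib_right add: geometric_sum)
  also have "\<dots> \<le> 2 ^ l * ?c" by (intro mult_right_mono) auto
  finally have "\<bar>\<Sum>l'<l. sum_list (map (discrepancy d) (descendants [2] l'))\<bar> \<le> 2 ^ l * ?c" .
  moreover have "\<bar>sum_list (map (discrepancy d) (take m (descendants [2] l)))\<bar> \<le> 2 ^ l * ?c"
    using discrepancy_take_descendants_le[of "[2]" d m l] assms by (simp add: ac_simps)
  ultimately have "\<bar>\<Sum>i<M. discrepancy d (kepler_word i)\<bar> \<le> 2 * ?c * 2 ^ l"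
    using sum_kepler_word[of m l "discrepancy d"] m unfolding M by (simp add: algebra_simps)
  also have "\<dots> \<le> 2 * ?c * (real M + 1)"
  proof (intro mult_left_mono)
    have "2 ^ l \<le> M + 1" unfolding M by simp
    then have "real (2 ^ l) \<le> real (M + 1)" by (rule of_nat_mono)
    then show "2 ^ l \<le> real M + 1" by simp
  qed simp
  finally show ?thesis .
qed

lemma length_kepler_word_le: "real (length (kepler_word M)) \<le> real M + 1"
proof -
  obtain l m where M: "M = 2 ^ l - 1 + m" and m: "m < 2 ^ l" using kepler_index .
  let ?t = "take (Suc m) (descendants [2] l)"
  have "?t \<noteq> []" using length_descendants[of "[2]" l] by auto
  \<comment> \<open>The word with index \<open>M\<close> is the last of the first
    \<open>M + 1\<close> words.\<close>
  moreover have "kepler_word M = last (map kepler_word [0..<2 ^ l - 1 + Suc m])"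
    by (simp add: M del: add_diff_assoc2 One_nat_def)
  ultimately have "kepler_word M = last ?t" using m map_kepler_word[of "Suc m" l] by simp
  then have "kepler_word M \<in> set (descendants [2] l)"
    using \<open>?t \<noteq> []\<close> last_in_set set_take_subset by (metis subsetD)
  then have "length (kepler_word M) \<le> 1 + l" using length_descendant_le[of _ "[2]" l] by simp
  also have "\<dots> \<le> 2 ^ l" using Suc_leI[OF less_exp[of l]] by simp
  also have "\<dots> \<le> M + 1" unfolding M by simp
  finally show ?thesis by simp
qed

text \<open>The last complete level \<open>k = l - 1\<close> suffices: its \<open>2 ^ k\<close>
  words have average length at least \<open>l / 2\<close>, while \<open>M + 1\<close> is at most
  \<open>4 * 2 ^ k\<close>. This gives the constant 8.\<close>

lemma sum_length_kepler_word_superlinear: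
  "\<forall>\<^sub>F M in sequentially. c * (real M + 1) \<le> (\<Sum>i<M. real (length (kepler_word i)))"
proof -
  obtain n0 where "8 * c \<le> real n0" using real_arch_simple by blast
  \<comment> \<open>With \<open>1 \<le> n\<close> the level \<open>l\<close> is positive, so a
    complete level exists.\<close>
  then obtain n where n: "8 * c \<le> real n" "1 \<le> n"
    using that[of "Suc n0"] by auto
  show ?thesis unfolding eventually_sequentially
  proof (intro exI[of _ "2 ^ n"] allI impI)
    fix M :: nat assume nM: "2 ^ n \<le> M"
    obtain l m where M: "M = 2 ^ l - 1 + m" and m: "m < 2 ^ l" using kepler_index .
    have "(2::nat) ^ n < 2 ^ Suc l" using nM M m by simp
    then have nl: "n \<le> l" by (simp del: power_Suc)
    then obtain k where k: "l = Suc k" using n by (cases l) auto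
    have "real M + 1 \<le> 2 ^ (l + 1)"
    proof -
      have "M + 1 \<le> 2 ^ (l + 1)" using M m by auto
      then have "real (M + 1) \<le> real (2 ^ (l + 1))" by (rule of_nat_mono)
      then show ?thesis by simp
    qed
    then have "c * (real M + 1) \<le> (real l / 8) * 2 ^ (l + 1)"
      using n nl by (intro order_trans[OF mult_right_mono[of c "real l / 8"] mult_left_mono]) auto
    also have "\<dots> \<le> 2 ^ k * (1 + real k / 2)" by (simp add: k field_simps)
    also have "\<dots> = sum_list (map (\<lambda>w. real (length w)) (descendants [2] k))"
      by (subst sum_length_descendants) auto
    also have "\<dots> \<le> (\<Sum>l'<l. sum_list (map (\<lambda>w. real (length w)) (descendants [2] l')))"
      unfolding k by (auto intro!: sum_nonneg sum_list_nonneg)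
    also have "\<dots> \<le> (\<Sum>i<M. real (length (kepler_word i)))"
      unfolding M sum_kepler_word[OF less_imp_le[OF m], of "\<lambda>w. real (length w)"]
      by (auto intro!: sum_list_nonneg)
    finally show "c * (real M + 1) \<le> (\<Sum>i<M. real (length (kepler_word i)))" .
  qed
qed

theorem theorem4p4: "minkowski_normal kepler_number"
proof -
  have "(\<lambda>n. real (block_count kepler_digits d n) / real n) \<longlonglongrightarrow> 1 / 2 ^ sum_list d"
    if d: "d \<noteq> []" "\<forall>e\<in>set d. 1 \<le> e" for d
  proof -
    have "kepler_word i \<noteq> []" for i
      using kepler_enum_reduced[of i] by (simp add: kepler_word_def is_reduced_cf_def)
    moreover have "\<bar>\<Sum>i<M. real (occ d (kepler_word i)) - 1 / 2 ^ sum_list d * real (length (kepler_word i))\<bar>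
        \<le> 2 * (real (sum_list d) + 2) * (real M + 1)" for M
      using discrepancy_kepler_word_le[OF d(2), of M] by (simp add: discrepancy_def)
    moreover have "real (length (kepler_word M)) \<le> 1 * (real M + 1)" for M
      using length_kepler_word_le[of M] by simp
    ultimately have "(\<lambda>n. real (block_count (concat_seq kepler_word) d n) / real n)
        \<longlonglongrightarrow> 1 / 2 ^ sum_list d"
      using d(1) by (intro block_frequency_concat_seq[where C = 1] sum_length_kepler_word_superlinear) auto
    moreover have "concat_seq kepler_word = kepler_digits"
      by (simp add: kepler_digits_def kepler_word_def[abs_def])
    ultimately show ?thesis by simp
  qed
  then show ?thesis
    unfolding minkowski_normal_def
    using kepler_number_bounds kepler_number_has_cf by (auto intro!: exI[of _ kepler_digits])
qed

end
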